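(* Let $1<q<\infty$. Let $\{a_k\}_{k=1}^\infty$ be a sequence of distinct values in $\mathbb{D}\setminus\{0\}$ and let $n>m\ge 1$ be integers. Then the following strict inequality holds: $$\sup_{g\in H^q,\ \|g\|_q=1}\left|\sum_{j=1}^m g(a_j)\,\frac{\prod_{k=1}^m(1-\overline{a_k}a_j)}{\prod_{k=1,\,k\ne j}^m(a_k-a_j)}\right|<\sup_{g\in H^q,\ \|g\|_q=1}\left|\sum_{j=1}^n g(a_j)\,\frac{\prod_{k=1}^n(1-\overline{a_k}a_j)}{\prod_{k=1,\,k\ne j}^n(a_k-a_j)}\right|.$$
   Context: $\mathbb{D}$ is the open unit disk. $H^q$ is the Hardy space of analytic functions on $\mathbb{D}$ with norm $\|g\|_q^q=\sup_{0<r<1}\frac1{2\pi}\int_0^{2\pi}|g(re^{i\theta})|^q\,d\theta$. Empty products equal $1$. *)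

theory Defs
  imports "HOL-Complex_Analysis.Complex_Analysis"
begin

definition hardy_mean :: "real \<Rightarrow> (complex \<Rightarrow> complex) \<Rightarrow> real \<Rightarrow> real" where
  "hardy_mean q g r =
     1 / (2 * pi) * integral {0..2 * pi} (\<lambda>\<theta>. cmod (g (of_real r * cis \<theta>)) powr q)"

(* Elements are total functions on the complex plane; only their values on the
   open unit disk matter. *)
definition hardy_space :: "real \<Rightarrow> (complex \<Rightarrow> complex) set" where
  "hardy_space q =
     {g. g holomorphic_on ball 0 1 \<and> bdd_above (hardy_mean q g ` {0<..<1})}"

(* The supremum is a real one, so this is meaningful only for g in hardy_space q. *)
definition hardy_norm :: "real \<Rightarrow> (complex \<Rightarrow> complex) \<Rightarrow> real" where
  "hardy_norm q g = (SUP r\<in>{0<..<1}. hardy_mean q g r) powr (1 / q)"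

definition eval_sum :: "(nat \<Rightarrow> complex) \<Rightarrow> nat \<Rightarrow> (complex \<Rightarrow> complex) \<Rightarrow> complex" where
  "eval_sum a n g =
     (\<Sum>j=1..n. g (a j) * ((\<Prod>k=1..n. 1 - cnj (a k) * a j) / (\<Prod>k\<in>{1..n} - {j}. a k - a j)))"

end

theory Submission
  imports Defs
begin

text \<open>
  Write \<open>p\<close> for the conjugate exponent of \<open>q\<close> and \<open>B\<^sub>n\<close> for the Blaschke product with zeros
  \<open>a 1, \<dots>, a n\<close>. The numbers multiplying \<open>g (a j)\<close> in the sum are, up to sign, the residues of
  \<open>1 / B\<^sub>n\<close>, so the functional is the circle mean of \<open>- g z \<cdot> z \<cdot> cnj (B\<^sub>n z)\<close>
  (lemma \<open>eval_sum_eq_circle_mean\<close>). Let \<open>S\<^sub>n\<close> be its norm. Multiplying a competitor for \<open>m\<close> by the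
  missing Blaschke factors gives a competitor for \<open>n\<close> of the same norm and value; this shows
  \<open>S\<^sub>m \<le> S\<^sub>n\<close>, and the point is to gain something.

  Young's inequality says that \<open>|f|^q / q + 1 / p - Re (f z \<cdot> z \<cdot> cnj (B\<^sub>n z)) \<ge> 0\<close> on the circle, with
  equality exactly where \<open>f = cnj z B\<^sub>n\<close>. Call the mean of this function the Young gap \<open>E\<^sub>n(f)\<close>. By
  homogeneity its infimum over \<open>f\<close> is \<open>(1 - S\<^sub>n^p) / p\<close>, so it is enough to compare infima of gaps.

  Let \<open>b\<close> be the Blaschke factor of \<open>\<alpha> = a (m + 1)\<close>. Instead of \<open>b f\<close> use as competitor for \<open>m + 1\<close>
  a function with boundary values \<open>b ((1 - s) f + s cnj z B\<^sub>m)\<close>, which moves \<open>f\<close> towards the pointwise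
  minimizer. The weight \<open>s\<close> must be positive and yet leave the result analytic: a small multiple of
  the Poisson kernel at \<open>\<alpha>\<close> has both properties, since its pole in the disc is cancelled by the zero of
  \<open>b\<close>. The gap density is convex in the value of \<open>f\<close> and vanishes at the minimizer, so it shrinks by
  the factor \<open>1 - s\<close>; hence \<open>E\<^sub>m\<^sub>+\<^sub>1(F) \<le> (1 - c) E\<^sub>m(f)\<close> with \<open>c > 0\<close> independent of \<open>f\<close>
  (lemma \<open>young_gap_step\<close>), that is, \<open>1 - S\<^sub>m\<^sub>+\<^sub>1^p \<le> (1 - c) (1 - S\<^sub>m^p)\<close>.

  This is a strict gain because \<open>S\<^sub>m < 1\<close> (lemma \<open>young_gap_bounded_below\<close>): as \<open>B\<^sub>m 0 \<noteq> 0\<close>, the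
  minimizer \<open>cnj z B\<^sub>m\<close> cannot be approached by analytic functions.

  Extremal functions and boundary values of Hardy functions are avoided: by dilation the supremum over
  the unit sphere of the Hardy space is a supremum over functions analytic on the closed disc
  (lemma \<open>SUP_hardy_sphere_eq\<close>), for which all means are integrals of continuous functions.
\<close>

section \<open>Means over the unit circle\<close>

definition circle_mean :: "(complex \<Rightarrow> real) \<Rightarrow> real" where
  "circle_mean F = 1 / (2 * pi) * integral {0..2 * pi} (\<lambda>\<theta>. F (cis \<theta>))"

lemma hardy_mean_eq_circle_mean:
  "hardy_mean q g r = circle_mean (\<lambda>z. cmod (g (of_real r * z)) powr q)"
  by (simp add: hardy_mean_def circle_mean_def)

lemma continuous_on_cis_sphere:
  fixes F :: "complex \<Rightarrow> 'a::topological_space"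
  assumes "continuous_on (sphere 0 1) F"
  shows "continuous_on A (\<lambda>\<theta>. F (cis \<theta>))"
  by (rule continuous_on_compose2[OF assms]) (auto intro!: continuous_intros)

lemma integrable_cis_sphere:
  fixes F :: "complex \<Rightarrow> real"
  assumes "continuous_on (sphere 0 1) F"
  shows "(\<lambda>\<theta>. F (cis \<theta>)) integrable_on {a..b}"
  by (intro integrable_continuous_real continuous_on_cis_sphere assms)

lemma continuous_on_cmod_powr:
  fixes f :: "'a::topological_space \<Rightarrow> complex"
  assumes "continuous_on A f" "0 < q"
  shows "continuous_on A (\<lambda>x. cmod (f x) powr q)"
  using assms by (intro continuous_on_powr') (auto intro!: continuous_intros)

lemma circle_mean_cong:
  assumes "\<And>z. cmod z = 1 \<Longrightarrow> F z = G z"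
  shows "circle_mean F = circle_mean G"
  unfolding circle_mean_def using assms by simp

lemma circle_mean_mono:
  assumes "continuous_on (sphere 0 1) F" "continuous_on (sphere 0 1) G"
    and "\<And>z. cmod z = 1 \<Longrightarrow> F z \<le> G z"
  shows "circle_mean F \<le> circle_mean G"
  unfolding circle_mean_def
  by (intro mult_left_mono integral_le integrable_cis_sphere assms) auto

lemma circle_mean_add:
  assumes "continuous_on (sphere 0 1) F" "continuous_on (sphere 0 1) G"
  shows "circle_mean (\<lambda>z. F z + G z) = circle_mean F + circle_mean G"
  unfolding circle_mean_def
  by (subst integral_add) (auto intro!: integrable_cis_sphere assms simp: algebra_simps)

lemma circle_mean_diff:
  assumes "continuous_on (sphere 0 1) F" "continuous_on (sphere 0 1) G"
  shows "circle_mean (\<lambda>z. F z - G z) = circle_mean F - circle_mean G"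
  unfolding circle_mean_def
  by (subst integral_diff) (auto intro!: integrable_cis_sphere assms simp: algebra_simps)

lemma circle_mean_cmult: "circle_mean (\<lambda>z. c * F z) = c * circle_mean F"
  by (simp add: circle_mean_def)

lemma circle_mean_const [simp]: "circle_mean (\<lambda>_. c) = c"
  by (simp add: circle_mean_def)

lemma circle_mean_rotate:
  assumes "continuous_on (sphere 0 1) F" "cmod w = 1"
  shows "circle_mean (\<lambda>z. F (w * z)) = circle_mean F"
proof -
  obtain t where t: "0 \<le> t" "t < 2 * pi" "w = cis t"
    using complex_unimodular_polar[OF assms(2)] by (metis cis.ctr)
  let ?G = "\<lambda>\<theta>. F (cis \<theta>)"
  have int: "?G integrable_on {a..b}" for a b
    by (rule integrable_cis_sphere[OF assms(1)])
  have shift: "integral {a..b} (\<lambda>\<theta>. ?G (\<theta> + c)) = integral {a + c..b + c} ?G" for a b c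
  proof -
    have "(?G has_integral integral {a + c..b + c} ?G) (cbox (a + c) (b + c))"
      using int by (simp add: integrable_integral)
    from has_integral_affinity[OF this, of 1 c] show ?thesis
      by (simp add: image_diff_atLeastAtMost integral_unique algebra_simps)
  qed
  have "integral {0..2 * pi} (\<lambda>\<theta>. F (w * cis \<theta>)) = integral {t..2 * pi + t} ?G"
    using shift[of 0 "2 * pi" t] by (simp add: t(3) cis_mult add.commute)
  also have "\<dots> = integral {t..2 * pi} ?G + integral {2 * pi..2 * pi + t} ?G"
    using t int by (intro Henstock_Kurzweil_Integration.integral_combine[symmetric]) auto
  also have "integral {2 * pi..2 * pi + t} ?G = integral {0..t} ?G"
    using shift[of 0 t "2 * pi"] by (simp add: cis_mult[symmetric] add.commute)
  also have "integral {t..2 * pi} ?G + integral {0..t} ?G = integral {0..2 * pi} ?G"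
    using t int Henstock_Kurzweil_Integration.integral_combine[of 0 t "2 * pi" ?G] by auto
  finally show ?thesis by (simp add: circle_mean_def)
qed

lemma circle_mean_Re_contour_integral:
  assumes "(G has_contour_integral I) (circlepath 0 1)"
  shows "circle_mean (\<lambda>z. Re (z * G z)) = Re (I / (2 * of_real pi * \<i>))"
proof -
  have "((\<lambda>t. G (cis t) * \<i> * cis t) has_integral I) {0..2 * pi}"
    using assms has_contour_integral_part_circlepath_iff[of 0 "2 * pi" G I 0 1]
    by (simp add: circlepath_def)
  then have "((\<lambda>t. Re ((1 / (2 * of_real pi * \<i>)) * (G (cis t) * \<i> * cis t)))
      has_integral Re ((1 / (2 * of_real pi * \<i>)) * I)) {0..2 * pi}"
    by (intro has_integral_Re has_integral_mult_right)
  then have "((\<lambda>t. 1 / (2 * pi) * Re (cis t * G (cis t)))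
      has_integral Re (I / (2 * of_real pi * \<i>))) {0..2 * pi}"
    by (simp add: field_simps Re_divide_of_real)
  then have "integral {0..2 * pi} (\<lambda>t. 1 / (2 * pi) * Re (cis t * G (cis t)))
      = Re (I / (2 * of_real pi * \<i>))"
    by (rule integral_unique)
  then show ?thesis by (simp add: circle_mean_def)
qed

section \<open>Functions analytic on the closed disc\<close>

lemma analytic_on_cball_imp_continuous:
  "f analytic_on cball 0 1 \<Longrightarrow> continuous_on (sphere 0 1) f"
  by (meson analytic_imp_holomorphic continuous_on_subset holomorphic_on_imp_continuous_on
      sphere_cball)

lemma analytic_on_cball_imp_holomorphic_on_ball:
  fixes f :: "complex \<Rightarrow> complex"
  assumes "f analytic_on cball 0 1"
  obtains R where "R > 1" "f holomorphic_on ball 0 R"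
proof -
  obtain T where T: "open T" "cball 0 1 \<subseteq> T" "f holomorphic_on T"
    using assms analytic_on_holomorphic by blast
  obtain e where e: "e > 0" "(\<Union>x\<in>cball 0 1. ball x e) \<subseteq> T"
    using compact_subset_open_imp_ball_epsilon_subset[OF compact_cball T(1,2)] by blast
  have "ball 0 (1 + e) \<subseteq> T"
  proof
    fix z :: complex
    assume z: "z \<in> ball 0 (1 + e)"
    show "z \<in> T"
    proof (cases "cmod z \<le> 1")
      case False
      have "dist (sgn z) z = cmod (of_real (1 / cmod z - 1) * z)"
        by (simp add: dist_norm sgn_div_norm algebra_simps scaleR_conv_of_real divide_inverse)
      also have "\<dots> = cmod z - 1"
        using False by (simp only: norm_mult norm_of_real) (auto simp: field_simps abs_if)
      finally have "z \<in> ball (sgn z) e" using z by simp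
      moreover have "sgn z \<in> cball 0 1" by (simp add: norm_sgn)
      ultimately show ?thesis using e(2) by blast
    qed (use T in auto)
  qed
  then show ?thesis
    using that[of "1 + e"] e(1) T(3) holomorphic_on_subset by auto
qed

lemma circle_mean_Re_analytic:
  assumes "f analytic_on cball 0 1"
  shows "circle_mean (\<lambda>z. Re (f z)) = Re (f 0)"
proof -
  have h: "f holomorphic_on cball 0 1"
    using assms analytic_imp_holomorphic by blast
  have "((\<lambda>u. f u / (u - 0)) has_contour_integral (2 * of_real pi * \<i> * f 0)) (circlepath 0 1)"
    using h by (intro Cauchy_integral_circlepath)
      (auto intro: holomorphic_on_imp_continuous_on holomorphic_on_subset)
  from circle_mean_Re_contour_integral[OF this]
  have "circle_mean (\<lambda>z. Re (z * (f z / z))) = Re (f 0)" by simp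
  moreover have "circle_mean (\<lambda>z. Re (z * (f z / z))) = circle_mean (\<lambda>z. Re (f z))"
    by (rule circle_mean_cong) auto
  ultimately show ?thesis by simp
qed

text \<open>
  Dualize: with \<open>c = |f|^(q-2) cnj f\<close> taken on the circle of radius \<open>r\<close>, the function
  \<open>H w\<close> = mean of \<open>c z \<cdot> f (w z)\<close> is holomorphic and \<open>H r = hardy_mean q f r\<close>. By the maximum principle
  \<open>Re (H r)\<close> is at most the maximum of \<open>Re H\<close> over the unit circle, where Young's inequality and
  rotation invariance bound it by the means over the two circles with weights \<open>1 / p\<close> and \<open>1 / q\<close>.
\<close>
lemma hardy_mean_mono:
  assumes f: "f analytic_on cball 0 1" and q: "1 < q" and r: "0 \<le> r" "r < 1"
  shows "hardy_mean q f r \<le> hardy_mean q f 1"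
proof -
  define p where "p = q / (q - 1)"
  have p: "p > 1" "1 / q + 1 / p = 1" using q by (auto simp: p_def field_simps)
  obtain R where R: "R > 1" "f holomorphic_on ball 0 R"
    using analytic_on_cball_imp_holomorphic_on_ball[OF f] .
  have fcont: "continuous_on (ball 0 R) f"
    using R(2) holomorphic_on_imp_continuous_on by blast
  (* The dual function: it has modulus |f|^(q-1) and satisfies c f = |f|^q on the circle of radius r. *)
  define c where "c = (\<lambda>z. cnj (sgn (f (of_real r * z))) * of_real (cmod (f (of_real r * z)) powr (q - 1)))"
  define A where "A = hardy_mean q f r"
  define N where "N = hardy_mean q f 1"
  have in_ball: "of_real r * z \<in> ball 0 R" if "cmod z = 1" for z :: complex
    using that r R by (simp add: norm_mult)
  have contr: "continuous_on (sphere 0 1) (\<lambda>z. f (of_real r * z))"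
    by (rule continuous_on_compose2[OF fcont]) (use in_ball in \<open>auto intro!: continuous_intros\<close>)
  have cf: "c z * f (of_real r * z) = of_real (cmod (f (of_real r * z)) powr q)" for z
  proof (cases "f (of_real r * z) = 0")
    case False
    have "cnj (sgn x) * x = of_real (cmod x)" if "x \<noteq> 0" for x :: complex
      using that complex_norm_square[of x]
      by (simp add: sgn_div_norm scaleR_conv_of_real field_simps power2_eq_square)
    then have "c z * f (of_real r * z)
        = of_real (cmod (f (of_real r * z))) * of_real (cmod (f (of_real r * z)) powr (q - 1))"
      using False by (simp add: c_def mult_ac)
    also have "\<dots> = of_real (cmod (f (of_real r * z)) powr q)"
      using False by (simp add: powr_diff)
    finally show ?thesis .
  qed (use q in simp)
  have cnorm: "cmod (c z) powr p = cmod (f (of_real r * z)) powr q" for z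
    using q by (cases "f (of_real r * z) = 0")
      (simp_all add: c_def norm_mult norm_sgn powr_powr p_def)
  have ccont: "continuous_on (sphere 0 1) c"
  proof -
    have "isCont (\<lambda>x::complex. cnj (sgn x) * of_real (cmod x powr (q - 1))) x" for x
    proof (cases "x = 0")
      case True
      have "((\<lambda>x::complex. cmod x powr (q - 1)) \<longlongrightarrow> 0) (at 0)"
        using q by (auto intro!: tendsto_eq_intros)
      then show ?thesis
        unfolding True isCont_def
        by (auto intro: Lim_null_comparison[where g="\<lambda>x::complex. cmod x powr (q - 1)"]
            simp: norm_mult norm_sgn eventually_at_filter)
    next
      case False
      then show ?thesis
        using q by (auto intro!: continuous_intros isCont_sgn simp: sgn_div_norm)
    qed
    then have "continuous_on UNIV (\<lambda>x::complex. cnj (sgn x) * of_real (cmod x powr (q - 1)))"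
      by (simp add: continuous_on_eq_continuous_at)
    from continuous_on_compose2[OF this contr] show ?thesis by (simp add: c_def)
  qed
  define H where "H = (\<lambda>w. of_real (1 / (2 * pi)) * integral (cbox 0 (2 * pi)) (\<lambda>\<theta>. c (cis \<theta>) * f (w * cis \<theta>)))"
  have ic: "continuous_on (cbox 0 (2 * pi)) (\<lambda>\<theta>. c (cis \<theta>) * f (w * cis \<theta>))" if "w \<in> ball 0 R" for w
    using that
    by (intro continuous_intros continuous_on_cis_sphere ccont continuous_on_compose2[OF fcont])
       (auto simp: norm_mult intro!: continuous_intros)
  have Hhol: "H holomorphic_on ball 0 R"
    unfolding H_def
  proof (intro holomorphic_intros leibniz_rule_holomorphic)
    fix w t assume w: "w \<in> ball (0::complex) R"
    have "(f has_field_derivative deriv f (w * cis t)) (at (w * cis t))"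
      using w R(2) by (intro holomorphic_derivI[of f "ball 0 R"]) (auto simp: norm_mult)
    then have "((\<lambda>w. c (cis t) * f (w * cis t)) has_field_derivative
        c (cis t) * (deriv f (w * cis t) * cis t)) (at w)"
      by (intro DERIV_cmult DERIV_chain2[of f]) (auto intro!: derivative_eq_intros)
    then show "((\<lambda>w. c (cis t) * f (w * cis t)) has_field_derivative
        (\<lambda>w t. c (cis t) * (deriv f (w * cis t) * cis t)) w t) (at w within ball 0 R)"
      by (simp add: has_field_derivative_at_within)
  next
    fix w assume "w \<in> ball (0::complex) R"
    then show "(\<lambda>\<theta>. c (cis \<theta>) * f (w * cis \<theta>)) integrable_on cbox 0 (2 * pi)"
      by (intro integrable_continuous ic)
  next
    have d: "continuous_on (ball 0 R) (deriv f)"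
      using R(2) by (intro holomorphic_on_imp_continuous_on holomorphic_deriv) auto
    show "continuous_on (ball 0 R \<times> cbox 0 (2 * pi))
        (\<lambda>(w, t). c (cis t) * (deriv f (w * cis t) * cis t))"
      unfolding case_prod_unfold
      by (intro continuous_intros continuous_on_compose2[OF d] continuous_on_compose2[OF ccont])
         (auto simp: norm_mult intro!: continuous_intros)
  qed auto
  have ReH: "Re (H w) = circle_mean (\<lambda>z. Re (c z * f (w * z)))" if "w \<in> ball 0 R" for w
  proof -
    have "((\<lambda>\<theta>. c (cis \<theta>) * f (w * cis \<theta>)) has_integral
        integral (cbox 0 (2 * pi)) (\<lambda>\<theta>. c (cis \<theta>) * f (w * cis \<theta>))) (cbox 0 (2 * pi))"
      by (intro integrable_integral integrable_continuous ic that)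
    from integral_unique[OF has_integral_Re[OF this]] show ?thesis
      by (simp add: circle_mean_def H_def)
  qed
  have cA: "continuous_on (sphere 0 1) (\<lambda>z. cmod (f (of_real r * z)) powr q)"
    using q by (intro continuous_on_cmod_powr contr) auto
  have bound: "Re (H w) \<le> A / p + N / q" if w: "cmod w = 1" for w
  proof -
    have cw: "continuous_on (sphere 0 1) (\<lambda>z. f (w * z))"
      by (rule continuous_on_compose2[OF fcont])
         (use w R in \<open>auto intro!: continuous_intros simp: norm_mult\<close>)
    have cN: "continuous_on (sphere 0 1) (\<lambda>z. cmod (f (w * z)) powr q)"
      using q by (intro continuous_on_cmod_powr cw) auto
    have c1: "continuous_on (sphere 0 1) (\<lambda>z. cmod (f z) powr q)"
      using q by (intro continuous_on_cmod_powr analytic_on_cball_imp_continuous f) auto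
    have "Re (H w) = circle_mean (\<lambda>z. Re (c z * f (w * z)))"
      using ReH w R by simp
    also have "\<dots> \<le> circle_mean (\<lambda>z. (1 / p) * cmod (f (of_real r * z)) powr q
                                   + (1 / q) * cmod (f (w * z)) powr q)"
    proof (rule circle_mean_mono)
      fix z
      have "Re (c z * f (w * z)) \<le> cmod (c z) * cmod (f (w * z))"
        by (metis complex_Re_le_cmod norm_mult)
      also have "\<dots> \<le> cmod (c z) powr p / p + cmod (f (w * z)) powr q / q"
        using p q by (intro Youngs_inequality) auto
      finally show "Re (c z * f (w * z)) \<le> (1 / p) * cmod (f (of_real r * z)) powr q
                                   + (1 / q) * cmod (f (w * z)) powr q"
        by (simp add: cnorm)
    qed (intro continuous_intros ccont cw cA cN)+
    also have "\<dots> = A / p + circle_mean (\<lambda>z. cmod (f (w * z)) powr q) / q"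
      by (subst circle_mean_add, (intro continuous_intros cA cN)+)
         (simp only: circle_mean_cmult A_def hardy_mean_eq_circle_mean, simp)
    also have "circle_mean (\<lambda>z. cmod (f (w * z)) powr q) = N"
      using circle_mean_rotate[OF c1 w] by (simp add: N_def hardy_mean_eq_circle_mean)
    finally show ?thesis .
  qed
  have "Re (H (of_real r)) \<le> A / p + N / q"
  proof (rule maximum_real_frontier[where S = "cball 0 1" and f = H and \<xi> = "of_real r"])
    show "continuous_on (closure (cball 0 1)) H"
      using Hhol R by (intro holomorphic_on_imp_continuous_on holomorphic_on_subset[OF Hhol]) auto
    show "H holomorphic_on interior (cball 0 1)"
      using R by (intro holomorphic_on_subset[OF Hhol]) auto
  qed (use r bound in auto)
  also have "Re (H (of_real r)) = A"
    using r R by (subst ReH) (auto simp: cf A_def hardy_mean_eq_circle_mean)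
  finally have "A * (1 - 1 / p) \<le> N / q" by (simp add: field_simps)
  also have "1 - 1 / p = 1 / q" using p by linarith
  finally show ?thesis using q by (simp add: A_def N_def divide_le_cancel)
qed

section \<open>Blaschke products and the integral form of the functional\<close>

definition blaschke :: "(nat \<Rightarrow> complex) \<Rightarrow> nat \<Rightarrow> complex \<Rightarrow> complex" where
  "blaschke a n z = (\<Prod>k=1..n. (a k - z) / (1 - cnj (a k) * z))"

lemma one_minus_cnj_mult_nonzero:
  assumes "cmod a < 1" "cmod z \<le> 1"
  shows "1 - cnj a * z \<noteq> 0"
proof
  assume "1 - cnj a * z = 0"
  then have "cmod (cnj a * z) = 1" by simp
  moreover have "cmod (cnj a * z) \<le> cmod a" 
    using assms mult_left_le[of "cmod z" "cmod a"] by (simp add: norm_mult)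
  ultimately show False using assms by simp
qed

lemma one_minus_cnj_mult_unimodular:
  assumes "cmod z = 1"
  shows "1 - cnj a * z = z * cnj (z - a)"
  using assms complex_norm_square[of z] by (simp add: algebra_simps)

lemma cmod_blaschke_factor:
  assumes "cmod a < 1" "cmod z = 1"
  shows "cmod ((a - z) / (1 - cnj a * z)) = 1"
proof -
  have "cmod (1 - cnj a * z) = cmod (a - z)"
    unfolding one_minus_cnj_mult_unimodular[OF assms(2)]
    using assms by (simp only: norm_mult complex_mod_cnj) (simp add: norm_minus_commute)
  moreover have "a \<noteq> z" using assms by auto
  ultimately show ?thesis by (simp add: norm_divide)
qed

lemma cmod_blaschke:
  assumes "\<And>k. k \<in> {1..n} \<Longrightarrow> cmod (a k) < 1" "cmod z = 1"
  shows "cmod (blaschke a n z) = 1"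
  unfolding blaschke_def prod_norm[symmetric]
  using cmod_blaschke_factor assms by (intro prod.neutral) blast

lemma analytic_on_blaschke_factor:
  assumes "cmod a < 1"
  shows "(\<lambda>z. (a - z) / (1 - cnj a * z)) analytic_on cball 0 1"
  using assms by (intro analytic_intros) (auto dest: one_minus_cnj_mult_nonzero)

lemma analytic_on_blaschke:
  assumes "\<And>k. k \<in> {1..n} \<Longrightarrow> cmod (a k) < 1"
  shows "blaschke a n analytic_on cball 0 1"
  unfolding blaschke_def
  using assms by (intro analytic_on_prod analytic_on_blaschke_factor)

lemma winding_number_circle_0:
  assumes "z \<notin> cball 0 1"
  shows "winding_number (circlepath 0 1) z = 0"
  by (rule winding_number_zero_outside[where s = "cball 0 1"]) (use assms in auto)

text \<open>
  On the circle \<open>cnj B = 1 / B\<close>, so the mean on the left is the contour integral of \<open>f / B\<close> divided by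
  \<open>2 \<pi> i\<close>; the residue of \<open>f / B\<close> at its simple pole \<open>a j\<close> is minus the \<open>j\<close>-th summand of the sum.
\<close>
lemma eval_sum_eq_circle_mean:
  assumes f: "f analytic_on cball 0 1" and inj: "inj_on a {1..n}"
    and a: "\<And>k. k \<in> {1..n} \<Longrightarrow> cmod (a k) < 1"
  shows "circle_mean (\<lambda>z. Re (f z * z * cnj (blaschke a n z))) = - Re (eval_sum a n f)"
proof -
  define P where "P = (\<lambda>z. \<Prod>k=1..n. 1 - cnj (a k) * z)"
  define Q where "Q = (\<lambda>z. \<Prod>k=1..n. a k - z)"
  define G where "G = (\<lambda>z. f z * P z / Q z)"
  obtain R where R: "R > 1" "f holomorphic_on ball 0 R"
    using analytic_on_cball_imp_holomorphic_on_ball[OF f] .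
  have res: "residue G (a j) = - (f (a j) * ((\<Prod>k=1..n. 1 - cnj (a k) * a j) / (\<Prod>k\<in>{1..n} - {j}. a k - a j)))"
    if j: "j \<in> {1..n}" for j
  proof -
    define T where "T = ball 0 R - a ` ({1..n} - {j})"
    define F where "F = (\<lambda>z. - (f z * P z / (\<Prod>k\<in>{1..n} - {j}. a k - z)))"
    have aj: "a j \<in> T"
      using j a[OF j] R inj by (auto simp: T_def dest: inj_onD)
    have "open T" unfolding T_def by (intro open_Diff finite_imp_closed) auto
    moreover have "F holomorphic_on T"
      unfolding F_def P_def T_def
      by (intro holomorphic_intros holomorphic_on_subset[OF R(2)]) auto
    ultimately have "residue (\<lambda>w. F w / (w - a j)) (a j) = F (a j)"
      using aj by (intro residue_simple)
    moreover have "G = (\<lambda>w. F w / (w - a j))"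
    proof
      fix w
      have "Q w = (a j - w) * (\<Prod>k\<in>{1..n} - {j}. a k - w)"
        unfolding Q_def using j by (simp add: prod.remove)
      also have "\<dots> = - ((\<Prod>k\<in>{1..n} - {j}. a k - w) * (w - a j))"
        by (simp add: algebra_simps)
      finally show "G w = F w / (w - a j)" by (simp add: G_def F_def)
    qed
    ultimately have "residue G (a j) = F (a j)" by simp
    then show ?thesis by (simp add: F_def P_def)
  qed
  have "(G has_contour_integral contour_integral (circlepath 0 1) G) (circlepath 0 1)"
  proof (intro has_contour_integral_integral contour_integrable_holomorphic_simple)
    show "open (ball 0 R - a ` {1..n})" by (intro open_Diff finite_imp_closed) auto
    show "G holomorphic_on ball 0 R - a ` {1..n}"
      unfolding G_def P_def Q_def
      by (intro holomorphic_intros holomorphic_on_subset[OF R(2)]) auto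
    show "path_image (circlepath 0 1) \<subseteq> ball 0 R - a ` {1..n}"
      using R a by (force simp: sphere_def)
  qed auto
  from circle_mean_Re_contour_integral[OF this]
  have "circle_mean (\<lambda>z. Re (z * G z))
      = Re (contour_integral (circlepath 0 1) G / (2 * of_real pi * \<i>))" .
  also have "contour_integral (circlepath 0 1) G
      = 2 * pi * \<i> * (\<Sum>p\<in>a ` {1..n}. winding_number (circlepath 0 1) p * residue G p)"
  proof (rule Residue_theorem)
    show "G holomorphic_on ball 0 R - a ` {1..n}"
      unfolding G_def P_def Q_def
      by (intro holomorphic_intros holomorphic_on_subset[OF R(2)]) auto
    show "path_image (circlepath 0 1) \<subseteq> ball 0 R - a ` {1..n}"
      using R a by (force simp: sphere_def)
    show "\<forall>z. z \<notin> ball 0 R \<longrightarrow> winding_number (circlepath 0 1) z = 0"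
      using R winding_number_circle_0 by auto
  qed auto
  also have "(\<Sum>p\<in>a ` {1..n}. winding_number (circlepath 0 1) p * residue G p)
      = (\<Sum>j\<in>{1..n}. residue G (a j))"
    using a by (subst sum.reindex[OF inj]) (auto intro!: sum.cong simp: winding_number_circlepath)
  also have "\<dots> = - eval_sum a n f"
    unfolding eval_sum_def sum_negf[symmetric] using res by (intro sum.cong) auto
  also have "of_real (2 * pi) * \<i> * - eval_sum a n f / (2 * of_real pi * \<i>) = - eval_sum a n f"
    by simp
  finally have "circle_mean (\<lambda>z. Re (z * G z)) = - Re (eval_sum a n f)" by simp
  moreover have "circle_mean (\<lambda>z. Re (z * G z)) = circle_mean (\<lambda>z. Re (f z * z * cnj (blaschke a n z)))"
  proof (rule circle_mean_cong)
    fix z :: complex assume z: "cmod z = 1"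
    have "blaschke a n z = Q z / P z" by (simp add: blaschke_def P_def Q_def prod_dividef)
    moreover have "cnj (blaschke a n z) * blaschke a n z = 1"
      using cmod_blaschke[of n a z] a z complex_norm_square[of "blaschke a n z"]
      by (simp add: mult.commute)
    ultimately have "cnj (blaschke a n z) = P z / Q z"
      by (metis divide_divide_eq_right mult.left_neutral mult_cancel_left1 nonzero_eq_divide_eq zero_neq_one mult_zero_right)
    then show "Re (z * G z) = Re (f z * z * cnj (blaschke a n z))"
      by (simp add: G_def mult_ac)
  qed
  ultimately show ?thesis by simp
qed

section \<open>The Young gap\<close>

definition young_gap_density :: "real \<Rightarrow> (nat \<Rightarrow> complex) \<Rightarrow> nat \<Rightarrow> (complex \<Rightarrow> complex) \<Rightarrow> complex \<Rightarrow> real" where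
  "young_gap_density q a n f z =
     cmod (f z) powr q / q + (1 - 1 / q) - Re (f z * z * cnj (blaschke a n z))"

definition young_gap :: "real \<Rightarrow> (nat \<Rightarrow> complex) \<Rightarrow> nat \<Rightarrow> (complex \<Rightarrow> complex) \<Rightarrow> real" where
  "young_gap q a n f = circle_mean (young_gap_density q a n f)"

lemma continuous_on_young_gap_density:
  assumes "f analytic_on cball 0 1" "1 < q" "\<And>k. k \<in> {1..n} \<Longrightarrow> cmod (a k) < 1"
  shows "continuous_on (sphere 0 1) (young_gap_density q a n f)"
  unfolding young_gap_density_def using assms(2)
  by (intro continuous_intros continuous_on_cmod_powr analytic_on_cball_imp_continuous
      assms analytic_on_blaschke) auto

lemma young_gap_eq:
  assumes f: "f analytic_on cball 0 1" and q: "1 < q" and inj: "inj_on a {1..n}"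
    and a: "\<And>k. k \<in> {1..n} \<Longrightarrow> cmod (a k) < 1"
  shows "young_gap q a n f = hardy_mean q f 1 / q + (1 - 1 / q) + Re (eval_sum a n f)"
proof -
  have c: "continuous_on (sphere 0 1) (\<lambda>z. cmod (f z) powr q)"
    using q by (intro continuous_on_cmod_powr analytic_on_cball_imp_continuous f) auto
  have d: "continuous_on (sphere 0 1) (\<lambda>z. Re (f z * z * cnj (blaschke a n z)))"
    by (intro continuous_intros analytic_on_cball_imp_continuous f analytic_on_blaschke a)
  have "young_gap q a n f = circle_mean (\<lambda>z. 1 / q * cmod (f z) powr q + (1 - 1 / q)
      - Re (f z * z * cnj (blaschke a n z)))"
    by (simp add: young_gap_def young_gap_density_def[abs_def])
  also have "\<dots> = circle_mean (\<lambda>z. 1 / q * cmod (f z) powr q) + (1 - 1 / q)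
      - circle_mean (\<lambda>z. Re (f z * z * cnj (blaschke a n z)))"
    by (subst circle_mean_diff, (intro continuous_intros c d)+,
        subst circle_mean_add, (intro continuous_intros c d)+) (simp only: circle_mean_const)
  also have "circle_mean (\<lambda>z. 1 / q * cmod (f z) powr q) = hardy_mean q f 1 / q"
    unfolding circle_mean_cmult by (simp add: hardy_mean_eq_circle_mean)
  finally show ?thesis
    using eval_sum_eq_circle_mean[OF f inj a] by simp
qed

lemma Re_mult_le_Young:
  assumes "1 < q"
  shows "Re (x * y) \<le> cmod x powr q / q + (1 - 1 / q) * cmod y powr (q / (q - 1))"
proof -
  have "Re (x * y) \<le> cmod x * cmod y" by (metis complex_Re_le_cmod norm_mult)
  also have "\<dots> \<le> cmod x powr q / q + cmod y powr (q / (q - 1)) / (q / (q - 1))"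
    using assms by (intro Youngs_inequality) (auto simp: field_simps)
  also have "\<dots> = cmod x powr q / q + (1 - 1 / q) * cmod y powr (q / (q - 1))"
    using assms by (simp add: field_simps)
  finally show ?thesis .
qed

lemma young_gap_density_nonneg:
  assumes "1 < q" "\<And>k. k \<in> {1..n} \<Longrightarrow> cmod (a k) < 1" "cmod z = 1"
  shows "0 \<le> young_gap_density q a n f z"
  using Re_mult_le_Young[OF assms(1), of "f z" "z * cnj (blaschke a n z)"]
    cmod_blaschke[of n a z] assms
  by (simp add: young_gap_density_def norm_mult mult.assoc)

section \<open>The gap is bounded away from zero\<close>

lemma exp_le_quadratic:
  fixes t :: real
  assumes "\<bar>t\<bar> \<le> 1"
  shows "exp t \<le> 1 + t + t\<^sup>2"
proof (cases "0 \<le> t")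
  case True
  then show ?thesis using exp_bound assms by auto
next
  case False
  define s where "s = - t"
  have s: "0 < s" using False by (simp add: s_def)
  have "exp t = 1 / exp s" by (simp add: s_def exp_minus field_simps)
  also have "\<dots> \<le> 1 / (1 + s)"
    using s by (intro divide_left_mono mult_pos_pos exp_ge_add_one_self) auto
  also have "\<dots> \<le> 1 - s + s\<^sup>2"
  proof -
    have "1 \<le> 1 + s ^ 3" using s by simp
    also have "\<dots> = (1 - s + s\<^sup>2) * (1 + s)" by (simp add: algebra_simps power2_eq_square power3_eq_cube)
    finally show ?thesis using s by (simp add: divide_le_eq)
  qed
  finally show ?thesis by (simp add: s_def)
qed

text \<open>
  The first-order expansion of \<open>|1 - w|^p\<close> at \<open>w = 0\<close> with an explicit quadratic error term: bound
  \<open>|1 - w|^2 = 1 + x\<close> by \<open>exp x\<close> before raising to the power \<open>p / 2\<close>.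
\<close>
lemma cmod_one_minus_powr_le:
  assumes p: "0 < p" and w: "cmod w \<le> e" "e \<le> 1" "3 * p * e \<le> 2"
  shows "cmod (1 - w) powr p \<le> 1 - p * Re w + (p / 2 + 9 * p\<^sup>2 / 4) * e\<^sup>2"
proof -
  define t where "t = (p / 2) * (- 2 * Re w + (cmod w)\<^sup>2)"
  have e: "0 \<le> e" using w norm_ge_zero[of w] by linarith
  have sq: "(cmod w)\<^sup>2 \<le> e\<^sup>2" using w by (simp add: power_mono)
  have "e\<^sup>2 \<le> e" using e w by (simp add: power2_eq_square mult_left_le)
  then have "\<bar>- 2 * Re w + (cmod w)\<^sup>2\<bar> \<le> 3 * e"
    using abs_Re_le_cmod[of w] w sq zero_le_power2[of "cmod w"] by linarith
  then have t: "\<bar>t\<bar> \<le> (p / 2) * (3 * e)"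
    unfolding t_def abs_mult using p by (intro mult_mono) auto
  have "(cmod (1 - w))\<^sup>2 = 1 + (- 2 * Re w + (cmod w)\<^sup>2)"
    by (simp add: cmod_power2) (simp add: power2_eq_square algebra_simps)
  also have "\<dots> \<le> exp (- 2 * Re w + (cmod w)\<^sup>2)" by (rule exp_ge_add_one_self)
  finally have "((cmod (1 - w))\<^sup>2) powr (p / 2) \<le> (exp (- 2 * Re w + (cmod w)\<^sup>2)) powr (p / 2)"
    using p by (intro powr_mono2) auto
  moreover have "((cmod (1 - w))\<^sup>2) powr (p / 2) = cmod (1 - w) powr p"
    by (simp add: powr_powr flip: powr_numeral)
  ultimately have "cmod (1 - w) powr p \<le> exp t"
    by (simp add: t_def powr_def mult.commute)
  also have "\<dots> \<le> 1 + t + t\<^sup>2"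
    using t w by (intro exp_le_quadratic) auto
  also have "t\<^sup>2 \<le> ((p / 2) * (3 * e))\<^sup>2"
    using t by (metis abs_ge_zero power2_abs power_mono)
  also have "t \<le> (p / 2) * (- 2 * Re w + e\<^sup>2)"
    unfolding t_def using p sq by (intro mult_left_mono) auto
  finally show ?thesis by (simp add: power_mult_distrib algebra_simps power2_eq_square)
qed

text \<open>
  For \<open>c\<close> a small positive multiple of \<open>cnj (B 0)\<close> the linear term \<open>- p Re (c B)\<close> has the negative mean
  \<open>- p Re (c B 0)\<close> and dominates the quadratic error.
\<close>
lemma circle_mean_one_minus_powr_less_one:
  assumes B: "B analytic_on cball 0 1" and le: "\<And>z. cmod z \<le> 1 \<Longrightarrow> cmod (B z) \<le> 1"
    and nz: "B 0 \<noteq> 0" and p: "0 < p"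
  obtains c where "circle_mean (\<lambda>z. cmod (1 - c * B z) powr p) < 1"
proof -
  define x where "x = (cmod (B 0))\<^sup>2"
  (* Any smaller positive e would do: this one meets the three conditions below and makes the
     quadratic error smaller than the linear gain p * e * x. *)
  define e where "e = x / (1 + 3 * p)"
  define c where "c = of_real e * cnj (B 0)"
  have x: "0 < x" "x \<le> 1" using nz le[of 0] by (auto simp: x_def power_le_one)
  have e: "0 < e" "e \<le> 1" "3 * p * e \<le> 2"
  proof -
    show "0 < e" using x p by (simp add: e_def)
    show "e \<le> 1" using x p by (simp add: e_def)
    have "3 * p * x \<le> 3 * p" using x p by simp
    also have "\<dots> \<le> 2 * (1 + 3 * p)" using p by simp
    finally show "3 * p * e \<le> 2" using p by (simp add: e_def divide_le_eq)
  qed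
  have cB: "cmod (c * B z) \<le> e" if "cmod z = 1" for z
  proof -
    have "cmod (B 0) * cmod (B z) \<le> 1 * 1" using le[of 0] le[of z] that by (intro mult_mono) auto
    then show ?thesis using e(1) by (simp add: c_def norm_mult mult.assoc)
  qed
  have cont: "continuous_on (sphere 0 1) B" by (rule analytic_on_cball_imp_continuous[OF B])
  let ?K = "(p / 2 + 9 * p\<^sup>2 / 4) * e\<^sup>2"
  have "circle_mean (\<lambda>z. cmod (1 - c * B z) powr p)
      \<le> circle_mean (\<lambda>z. (1 + ?K) - p * Re (c * B z))"
  proof (rule circle_mean_mono)
    show "continuous_on (sphere 0 1) (\<lambda>z. cmod (1 - c * B z) powr p)"
      by (intro continuous_on_cmod_powr continuous_intros cont p)
    show "continuous_on (sphere 0 1) (\<lambda>z. (1 + ?K) - p * Re (c * B z))"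
      by (intro continuous_intros cont)
    fix z :: complex assume "cmod z = 1"
    from cmod_one_minus_powr_le[OF p cB[OF this] e(2,3)]
    show "cmod (1 - c * B z) powr p \<le> (1 + ?K) - p * Re (c * B z)" by simp
  qed
  also have "\<dots> = (1 + ?K) - p * circle_mean (\<lambda>z. Re (c * B z))"
    by (subst circle_mean_diff, (intro continuous_intros cont)+)
       (simp only: circle_mean_const circle_mean_cmult)
  also have "circle_mean (\<lambda>z. Re (c * B z)) = Re (c * B 0)"
    by (rule circle_mean_Re_analytic) (intro analytic_intros B)
  also have "c * B 0 = of_real (e * x)"
    using complex_norm_square[of "B 0"] by (simp add: c_def x_def mult_ac)
  also have "(1 + ?K) - p * Re (of_real (e * x)) < 1"
  proof -
    have "(1 / 2 + 9 * p / 4) * e < (1 + 3 * p) * e" using p e by simp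
    also have "\<dots> = x" using p by (simp add: e_def)
    finally have "(p * e) * ((1 / 2 + 9 * p / 4) * e) < (p * e) * x"
      using p e by (intro mult_strict_left_mono) auto
    then show ?thesis by (simp add: algebra_simps power2_eq_square)
  qed
  finally show ?thesis using that by blast
qed

lemma cmod_blaschke_le:
  assumes "\<And>k. k \<in> {1..n} \<Longrightarrow> cmod (a k) < 1" "cmod z \<le> 1"
  shows "cmod (blaschke a n z) \<le> 1"
proof (rule maximum_modulus_frontier[where S = "cball 0 1" and f = "blaschke a n" and \<xi> = z])
  have h: "blaschke a n holomorphic_on cball 0 1"
    using analytic_on_blaschke[of n a] assms(1) analytic_imp_holomorphic by blast
  show "blaschke a n holomorphic_on interior (cball 0 1)"
    by (rule holomorphic_on_subset[OF h]) auto
  show "continuous_on (closure (cball 0 1)) (blaschke a n)"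
    using h holomorphic_on_imp_continuous_on by auto
qed (use assms cmod_blaschke[of n a] in auto)

text \<open>
  The mean of \<open>f z \<cdot> z \<cdot> c\<close> is zero for every constant \<open>c\<close>, so \<open>cnj B\<close> may be replaced by \<open>cnj B - c\<close>
  before Young's inequality is applied. On the circle \<open>|cnj B - c| = |1 - c B|\<close>, and \<open>c\<close> can be chosen
  such that the \<open>p\<close>-th power of this has mean less than one because \<open>B 0 \<noteq> 0\<close>. This is where nonzero
  nodes matter: with a single node at the origin the constant function \<open>- 1\<close> has gap zero.
\<close>
lemma young_gap_bounded_below:
  assumes q: "1 < q" and a: "\<And>k. k \<in> {1..n} \<Longrightarrow> cmod (a k) < 1 \<and> a k \<noteq> 0"
  obtains \<kappa> where "0 < \<kappa>" "\<And>f. f analytic_on cball 0 1 \<Longrightarrow> \<kappa> \<le> young_gap q a n f"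
proof -
  define p where "p = q / (q - 1)"
  have p: "0 < p" using q by (simp add: p_def)
  let ?B = "blaschke a n"
  have B: "?B analytic_on cball 0 1" using a by (intro analytic_on_blaschke) auto
  have "?B 0 \<noteq> 0" using a by (auto simp: blaschke_def)
  then obtain c where c: "circle_mean (\<lambda>z. cmod (1 - c * ?B z) powr p) < 1"
    using circle_mean_one_minus_powr_less_one[OF B _ _ p] cmod_blaschke_le[of n a] a by metis
  let ?M = "circle_mean (\<lambda>z. cmod (1 - c * ?B z) powr p)"
  have "(1 - 1 / q) * (1 - ?M) \<le> young_gap q a n f" if f: "f analytic_on cball 0 1" for f
  proof -
    have fc: "continuous_on (sphere 0 1) f" and Bc: "continuous_on (sphere 0 1) ?B"
      by (intro analytic_on_cball_imp_continuous f B)+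
    have Pc: "continuous_on (sphere 0 1) (\<lambda>z. cmod (1 - c * ?B z) powr p)"
      by (intro continuous_on_cmod_powr continuous_intros Bc p)
    have "(1 - 1 / q) * (1 - ?M) = (1 - 1 / q) * (1 - ?M) - circle_mean (\<lambda>z. Re (f z * z * c))"
      using circle_mean_Re_analytic[of "\<lambda>z. f z * z * c"]
      by (simp add: analytic_intros f del: times_complex.simps)
    also have "\<dots> = circle_mean (\<lambda>z. (1 - 1 / q) * (1 - cmod (1 - c * ?B z) powr p) - Re (f z * z * c))"
      by (subst circle_mean_diff, (intro continuous_intros fc Pc)+, subst circle_mean_cmult,
          subst circle_mean_diff, (intro continuous_intros fc Pc)+) (simp only: circle_mean_const)
    also have "\<dots> \<le> young_gap q a n f"
      unfolding young_gap_def
    proof (rule circle_mean_mono)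
      show "continuous_on (sphere 0 1) (young_gap_density q a n f)"
        using a by (intro continuous_on_young_gap_density f q) auto
      fix z :: complex assume z: "cmod z = 1"
      have one: "cnj (?B z) * ?B z = 1"
        using cmod_blaschke[of n a z] a z complex_norm_square[of "?B z"] by (simp add: mult.commute)
      have "cnj (?B z) - c = cnj (?B z) * (1 - c * ?B z)"
        using one by (simp add: algebra_simps)
      then have "cmod (cnj (?B z) - c) = cmod (1 - c * ?B z)"
        using cmod_blaschke[of n a z] a z by (simp add: norm_mult)
      then have "Re (f z * (z * (cnj (?B z) - c)))
          \<le> cmod (f z) powr q / q + (1 - 1 / q) * cmod (1 - c * ?B z) powr p"
        using Re_mult_le_Young[OF q, of "f z" "z * (cnj (?B z) - c)"] z
        by (simp add: norm_mult p_def)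
      moreover have "f z * (z * (cnj (?B z) - c)) = f z * z * cnj (?B z) - f z * z * c"
        by (simp add: algebra_simps)
      ultimately show "(1 - 1 / q) * (1 - cmod (1 - c * ?B z) powr p) - Re (f z * z * c)
          \<le> young_gap_density q a n f z"
        by (simp add: young_gap_density_def algebra_simps del: times_complex.simps)
    qed (intro continuous_intros fc Pc)
    finally show ?thesis .
  qed
  moreover have "0 < (1 - 1 / q) * (1 - ?M)" using q c by simp
  ultimately show ?thesis using that by blast
qed

section \<open>An additional node shrinks the gap by a fixed factor\<close>

lemma powr_convex_combination_one_le:
  fixes x q s :: real
  assumes "1 < q" "0 \<le> x" "0 \<le> s" "s \<le> 1"
  shows "((1 - s) * x + s) powr q \<le> (1 - s) * x powr q + s"
proof (cases "x = 0")
  case True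
  then show ?thesis using assms powr_mono'[of 1 q s] by simp
next
  case False
  then show ?thesis
    using convex_onD[OF powr_convex, of q s x 1] assms by (simp add: algebra_simps)
qed

text \<open>
  The new function has the boundary values \<open>b ((1 - s) f + s cnj z B)\<close>, where \<open>b\<close> is the Blaschke factor
  of \<open>\<alpha>\<close> and \<open>s z = (1 - |\<alpha>|)^2 / |1 - cnj \<alpha> z|^2\<close> is the Poisson kernel at \<open>\<alpha>\<close> scaled so that \<open>s \<le> 1\<close>.
  It is analytic because on the circle \<open>b s\<close> agrees with \<open>- (1 - |\<alpha>|)^2 z / (1 - cnj \<alpha> z)^2\<close>. Since \<open>|b| = 1\<close>
  and \<open>|cnj z B| = 1\<close>, convexity of the \<open>q\<close>-th power bounds its gap density by \<open>1 - s\<close> times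
  that of \<open>f\<close>, and \<open>s\<close> is at least the constant in the conclusion.
\<close>
lemma young_gap_step:
  assumes f: "f analytic_on cball 0 1" and q: "1 < q"
    and a: "\<And>k. k \<in> {1..Suc m} \<Longrightarrow> cmod (a k) < 1"
  obtains F where "F analytic_on cball 0 1"
    "young_gap q a (Suc m) F
       \<le> (1 - ((1 - cmod (a (Suc m))) / (1 + cmod (a (Suc m))))\<^sup>2) * young_gap q a m f"
proof -
  define \<alpha> where "\<alpha> = a (Suc m)"
  define B where "B = blaschke a m"
  define b where "b = (\<lambda>z. (\<alpha> - z) / (1 - cnj \<alpha> * z))"
  define s where "s = (\<lambda>z. (1 - cmod \<alpha>)\<^sup>2 / (cmod (1 - cnj \<alpha> * z))\<^sup>2)"
  define c where "c = ((1 - cmod \<alpha>) / (1 + cmod \<alpha>))\<^sup>2"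
  define F where "F = (\<lambda>z. b z * f z
      - of_real ((1 - cmod \<alpha>)\<^sup>2) / (1 - cnj \<alpha> * z)\<^sup>2 * (B z - z * f z))"
  have \<alpha>: "cmod \<alpha> < 1" using a by (simp add: \<alpha>_def)
  have am: "\<And>k. k \<in> {1..m} \<Longrightarrow> cmod (a k) < 1" using a by simp
  have FA: "F analytic_on cball 0 1"
    unfolding F_def b_def B_def
    using \<alpha> by (intro analytic_intros f analytic_on_blaschke am)
      (auto dest: one_minus_cnj_mult_nonzero)
  have pointwise: "young_gap_density q a (Suc m) F z \<le> (1 - c) * young_gap_density q a m f z"
    if z: "cmod z = 1" for z
  proof -
    have nz: "1 - cnj \<alpha> * z \<noteq> 0" using one_minus_cnj_mult_nonzero[OF \<alpha>] z by simp
    have zz: "cnj z * z = 1" using z complex_norm_square[of z] by (simp add: mult.commute)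
    have BB: "B z * cnj (B z) = 1"
      using cmod_blaschke[of m a z] am z complex_norm_square[of "B z"] by (simp add: B_def)
    have bb: "b z * cnj (b z) = 1"
      using cmod_blaschke_factor[OF \<alpha> z] complex_norm_square[of "b z"] by (simp add: b_def)
    have up: "cmod (1 - cnj \<alpha> * z) \<le> 1 + cmod \<alpha>"
      using norm_triangle_ineq4[of 1 "cnj \<alpha> * z"] z by (simp add: norm_mult)
    have low: "1 - cmod \<alpha> \<le> cmod (1 - cnj \<alpha> * z)"
      using norm_triangle_ineq2[of 1 "cnj \<alpha> * z"] z by (simp add: norm_mult)
    have s0: "0 \<le> s z" by (simp add: s_def)
    have s1: "s z \<le> 1"
      using nz low \<alpha> by (simp add: s_def divide_le_eq power_mono)
    have sc: "c \<le> s z"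
      unfolding s_def c_def power_divide
      using up nz \<alpha> by (intro divide_left_mono power_mono mult_pos_pos) auto
    have bs: "b z * of_real (s z) = - (of_real ((1 - cmod \<alpha>)\<^sup>2) / (1 - cnj \<alpha> * z)\<^sup>2 * z)"
    proof -
      have "of_real ((cmod (1 - cnj \<alpha> * z))\<^sup>2) = (1 - cnj \<alpha> * z) * cnj (1 - cnj \<alpha> * z)"
        by (rule complex_norm_square)
      also have "cnj (1 - cnj \<alpha> * z) = - (cnj z * (\<alpha> - z))"
        using one_minus_cnj_mult_unimodular[OF z, of \<alpha>] by (simp add: algebra_simps)
      finally have eq: "of_real ((cmod (1 - cnj \<alpha> * z))\<^sup>2) = - (1 - cnj \<alpha> * z) * (cnj z * (\<alpha> - z))"
        by (simp only: mult_minus_left mult_minus_right)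
      have nza: "\<alpha> - z \<noteq> 0" "cnj z \<noteq> 0" using \<alpha> z by auto
      have "b z * of_real (s z) = (\<alpha> - z) / (1 - cnj \<alpha> * z) * (of_real ((1 - cmod \<alpha>)\<^sup>2) / of_real ((cmod (1 - cnj \<alpha> * z))\<^sup>2))"
        by (simp add: b_def s_def)
      also have "\<dots> = - (of_real ((1 - cmod \<alpha>)\<^sup>2) / (1 - cnj \<alpha> * z)\<^sup>2 / cnj z)"
      proof -
        have "u / d * (K / (- d * (w * u))) = - (K / d\<^sup>2 / w)"
          if "d \<noteq> 0" "u \<noteq> 0" "w \<noteq> 0" for u d w K :: complex
          using that by (simp add: field_simps power2_eq_square)
        from this[OF nz nza] show ?thesis unfolding eq .
      qed
      also have "\<dots> = - (of_real ((1 - cmod \<alpha>)\<^sup>2) / (1 - cnj \<alpha> * z)\<^sup>2 * z)"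
        unfolding divide_inverse[of _ "cnj z"] inverse_unique[OF zz] by (rule refl)
      finally show ?thesis .
    qed
    have Fz: "F z = b z * (of_real (1 - s z) * f z + of_real (s z) * (cnj z * B z))"
    proof -
      have "b z * (of_real (1 - s z) * f z + of_real (s z) * (cnj z * B z))
          = b z * f z + (b z * of_real (s z)) * (cnj z * B z - f z)"
        by (simp add: algebra_simps)
      also have "\<dots> = b z * f z - of_real ((1 - cmod \<alpha>)\<^sup>2) / (1 - cnj \<alpha> * z)\<^sup>2 * (z * cnj z * B z - z * f z)"
        unfolding bs by (simp add: algebra_simps)
      finally show ?thesis using zz by (simp add: F_def mult.commute)
    qed
    have "cmod (F z) = cmod (of_real (1 - s z) * f z + of_real (s z) * (cnj z * B z))"
      unfolding Fz norm_mult[of "b z"] using cmod_blaschke_factor[OF \<alpha> z] by (simp add: b_def)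
    also have "\<dots> \<le> cmod (of_real (1 - s z) * f z) + cmod (of_real (s z) * (cnj z * B z))"
      by (rule norm_triangle_ineq)
    also have "\<dots> = (1 - s z) * cmod (f z) + s z"
      using s0 s1 z cmod_blaschke[of m a z] am
      by (simp only: norm_mult norm_of_real complex_mod_cnj B_def)
    finally have "cmod (F z) powr q \<le> ((1 - s z) * cmod (f z) + s z) powr q"
      using q by (intro powr_mono2) auto
    also have "\<dots> \<le> (1 - s z) * cmod (f z) powr q + s z"
      by (intro powr_convex_combination_one_le q s0 s1) auto
    finally have Fq: "cmod (F z) powr q / q \<le> ((1 - s z) * cmod (f z) powr q + s z) / q"
      using q by (simp add: divide_right_mono)
    have "blaschke a (Suc m) z = B z * b z"
      by (simp add: blaschke_def B_def b_def \<alpha>_def)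
    then have Fprod: "F z * z * cnj (blaschke a (Suc m) z)
        = (b z * cnj (b z)) * (of_real (1 - s z) * (f z * z * cnj (B z))
            + of_real (s z) * ((cnj z * z) * (B z * cnj (B z))))"
      by (simp add: Fz algebra_simps)
    have "Re (of_real u * w + of_real v) = u * Re w + v" for u v :: real and w :: complex
      by simp
    then have "Re (F z * z * cnj (blaschke a (Suc m) z))
        = (1 - s z) * Re (f z * z * cnj (B z)) + s z"
      unfolding Fprod bb zz BB mult_1_left mult_1_right .
    then have "young_gap_density q a (Suc m) F z
        \<le> ((1 - s z) * cmod (f z) powr q + s z) / q + (1 - 1 / q)
            - ((1 - s z) * Re (f z * z * cnj (B z)) + s z)"
      using Fq by (simp only: young_gap_density_def)
    also have "\<dots> = (1 - s z) * young_gap_density q a m f z"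
      using q by (simp only: young_gap_density_def B_def) (simp add: field_simps)
    also have "\<dots> \<le> (1 - c) * young_gap_density q a m f z"
      using young_gap_density_nonneg[of q m a z f] q am z sc by (intro mult_right_mono) auto
    finally show ?thesis .
  qed
  have "young_gap q a (Suc m) F \<le> circle_mean (\<lambda>z. (1 - c) * young_gap_density q a m f z)"
    unfolding young_gap_def
    by (intro circle_mean_mono continuous_on_young_gap_density continuous_intros
        FA f q a am pointwise)
  then have "young_gap q a (Suc m) F \<le> (1 - c) * young_gap q a m f"
    by (simp only: circle_mean_cmult young_gap_def)
  then show ?thesis using that[OF FA] by (simp only: c_def \<alpha>_def)
qed

section \<open>From the Hardy space to functions analytic on the closed disc\<close>

lemma hardy_mean_nonneg: "0 \<le> hardy_mean q g r"
proof (cases "(\<lambda>\<theta>. cmod (g (of_real r * cis \<theta>)) powr q) integrable_on {0..2 * pi}")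
  case True
  then show ?thesis by (simp add: hardy_mean_def Henstock_Kurzweil_Integration.integral_nonneg)
qed (simp add: hardy_mean_def not_integrable_integral)

lemma hardy_mean_cmult: "hardy_mean q (\<lambda>z. c * g z) r = cmod c powr q * hardy_mean q g r"
  by (simp add: hardy_mean_def norm_mult powr_mult)

lemma eval_sum_cmult: "eval_sum a n (\<lambda>z. c * g z) = c * eval_sum a n g"
  by (simp add: eval_sum_def sum_distrib_left mult.assoc)

text \<open>
  From left to right, the dilations \<open>z \<mapsto> g (r z)\<close> are analytic on the closed disc and their values at the
  nodes converge to those of \<open>g\<close> as \<open>r\<close> tends to 1. From right to left, monotonicity of the means shows
  that \<open>f\<close> has Hardy norm at most 1, and normalizing \<open>f\<close> only increases the functional. A function of
  norm zero cannot be normalized, but it vanishes at every node.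
\<close>
lemma SUP_hardy_sphere_eq:
  assumes q: "1 < q" and a: "\<And>k. k \<in> {1..n} \<Longrightarrow> cmod (a k) < 1 \<and> a k \<noteq> 0"
  shows "(SUP g\<in>{g \<in> hardy_space q. hardy_norm q g = 1}. ereal (cmod (eval_sum a n g)))
    = (SUP f\<in>{f. f analytic_on cball 0 1 \<and> hardy_mean q f 1 \<le> 1}. ereal (cmod (eval_sum a n f)))"
    (is "?S = ?T")
proof (rule antisym)
  show "?S \<le> ?T"
  proof (rule SUP_least)
    fix g assume "g \<in> {g \<in> hardy_space q. hardy_norm q g = 1}"
    then have g: "g holomorphic_on ball 0 1" "bdd_above (hardy_mean q g ` {0<..<1})"
      and n: "(SUP r\<in>{0<..<1}. hardy_mean q g r) powr (1 / q) = 1"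
      by (auto simp: hardy_space_def hardy_norm_def)
    have le: "hardy_mean q g r \<le> (SUP r\<in>{0<..<1}. hardy_mean q g r)" if "0 < r" "r < 1" for r
      using that g(2) by (intro cSUP_upper) auto
    have "0 \<le> (SUP r\<in>{0<..<1}. hardy_mean q g r)"
      using le[of "1/2"] hardy_mean_nonneg[of q g "1/2"] by simp
    then have "(SUP r\<in>{0<..<1}. hardy_mean q g r)
        = ((SUP r\<in>{0<..<1}. hardy_mean q g r) powr (1 / q)) powr q"
      using q by (simp add: powr_powr)
    then have "(SUP r\<in>{0<..<1}. hardy_mean q g r) = 1" by (simp add: n)
    with le have mean: "hardy_mean q g r \<le> 1" if "0 < r" "r < 1" for r
      using that by simp
    define d where "d = (\<lambda>r z. g (of_real r * z))"
    have d: "ereal (cmod (eval_sum a n (d r))) \<le> ?T" if r: "0 < r" "r < 1" for r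
    proof (rule SUP_upper)
      have "d r holomorphic_on ball 0 (1 / r)"
        unfolding d_def
        by (rule holomorphic_on_compose_gen[OF _ g(1), unfolded o_def])
           (use r in \<open>auto intro!: holomorphic_intros simp: norm_mult field_simps\<close>)
      then have "d r analytic_on cball 0 1"
        unfolding analytic_on_holomorphic
      proof (intro exI[of _ "ball 0 (1 / r)"] conjI)
        have "1 < 1 / r" using r by simp
        then show "cball 0 1 \<subseteq> ball (0::complex) (1 / r)" by auto
      qed auto
      moreover have "hardy_mean q (d r) 1 = hardy_mean q g r" by (simp add: hardy_mean_def d_def)
      ultimately show "d r \<in> {f. f analytic_on cball 0 1 \<and> hardy_mean q f 1 \<le> 1}"
        using mean[OF r] by simp
    qed
    have "((\<lambda>r. d r (a j)) \<longlongrightarrow> g (a j)) (at_left 1)" if "j \<in> {1..n}" for j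
    proof -
      have "isCont g (a j)"
        using a[OF that]
        by (intro continuous_on_interior[OF holomorphic_on_imp_continuous_on[OF g(1)]]) simp
      moreover have "((\<lambda>r. of_real r * a j) \<longlongrightarrow> a j) (at_left 1)"
        by (auto intro!: tendsto_eq_intros)
      ultimately show ?thesis unfolding d_def by (rule isCont_tendsto_compose)
    qed
    then have "((\<lambda>r. cmod (eval_sum a n (d r))) \<longlongrightarrow> cmod (eval_sum a n g)) (at_left 1)"
      unfolding eval_sum_def by (intro tendsto_intros) auto
    then have "((\<lambda>r. ereal (cmod (eval_sum a n (d r)))) \<longlongrightarrow> ereal (cmod (eval_sum a n g))) (at_left 1)"
      by simp
    moreover have "\<forall>\<^sub>F r in at_left 1. ereal (cmod (eval_sum a n (d r))) \<le> ?T"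
      using eventually_at_left_real[of 0 "1::real"] d by (auto elim!: eventually_mono)
    ultimately show "ereal (cmod (eval_sum a n g)) \<le> ?T"
      by (rule tendsto_upperbound) simp
  qed
next
  show "?T \<le> ?S"
  proof (rule SUP_least)
    fix f assume "f \<in> {f. f analytic_on cball 0 1 \<and> hardy_mean q f 1 \<le> 1}"
    then have f: "f analytic_on cball 0 1" "hardy_mean q f 1 \<le> 1" by auto
    have fh: "f holomorphic_on cball 0 1" using f(1) analytic_imp_holomorphic by blast
    have mean: "hardy_mean q f r \<le> 1" if "0 < r" "r < 1" for r
      using hardy_mean_mono[OF f(1) q, of r] f(2) that by simp
    define \<sigma> where "\<sigma> = (SUP r\<in>{0<..<1}. hardy_mean q f r)"
    have bdd: "bdd_above (hardy_mean q f ` {0<..<1})"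
      using mean by (auto intro!: bdd_aboveI2)
    have le: "hardy_mean q f r \<le> \<sigma>" if "0 < r" "r < 1" for r
      unfolding \<sigma>_def using that bdd by (intro cSUP_upper) auto
    have \<sigma>: "0 \<le> \<sigma>" "\<sigma> \<le> 1"
    proof -
      show "0 \<le> \<sigma>" using le[of "1/2"] hardy_mean_nonneg[of q f "1/2"] by simp
      show "\<sigma> \<le> 1" unfolding \<sigma>_def using mean by (intro cSUP_least) auto
    qed
    show "ereal (cmod (eval_sum a n f)) \<le> ?S"
    proof (cases "\<sigma> = 0")
      case True
      have "f (a j) = 0" if j: "j \<in> {1..n}" for j
      proof -
        define r where "r = cmod (a j)"
        have r: "0 < r" "r < 1" using a[OF j] by (auto simp: r_def)
        have "hardy_mean q f r = 0"
          using le[OF r] hardy_mean_nonneg[of q f r] True by simp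
        then have "integral {0..2 * pi} (\<lambda>\<theta>. cmod (f (of_real r * cis \<theta>)) powr q) = 0"
          by (simp add: hardy_mean_def)
        moreover have "continuous_on {0..2 * pi} (\<lambda>\<theta>. f (of_real r * cis \<theta>))"
          by (rule continuous_on_compose2[OF holomorphic_on_imp_continuous_on[OF fh]])
             (use r in \<open>auto intro!: continuous_intros simp: norm_mult\<close>)
        then have "continuous_on {0..2 * pi} (\<lambda>\<theta>. cmod (f (of_real r * cis \<theta>)) powr q)"
          using q by (intro continuous_on_cmod_powr) auto
        ultimately have "\<forall>\<theta>\<in>{0..2 * pi}. cmod (f (of_real r * cis \<theta>)) powr q = 0"
          by (subst (asm) integral_eq_0_iff) auto
        moreover obtain \<theta> where "\<theta> \<in> {0..2 * pi}" "a j = of_real r * cis \<theta>"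
        proof -
          have "cmod (sgn (a j)) = 1" using a[OF j] by (simp add: norm_sgn)
          then obtain t where "0 \<le> t" "t < 2 * pi" "sgn (a j) = cis t"
            using complex_unimodular_polar by (metis cis.ctr)
          moreover have "a j = of_real r * sgn (a j)"
            using a[OF j] by (simp add: r_def sgn_div_norm scaleR_conv_of_real)
          ultimately show thesis using that[of t] by simp
        qed
        ultimately show ?thesis by auto
      qed
      then have 0: "eval_sum a n f = 0" by (simp add: eval_sum_def)
      (* The supremum is over a nonempty set, so it is at least 0. *)
      have "hardy_mean q (\<lambda>_. 1) r = 1" for r by (simp add: hardy_mean_eq_circle_mean)
      then have "(\<lambda>_. 1) \<in> {g \<in> hardy_space q. hardy_norm q g = 1}"
        by (simp add: hardy_space_def hardy_norm_def image_constant_conv)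
      then have "ereal (cmod (eval_sum a n (\<lambda>_. 1))) \<le> ?S" by (rule SUP_upper)
      moreover have "ereal (cmod (eval_sum a n f)) \<le> ereal (cmod (eval_sum a n (\<lambda>_. 1)))"
        using 0 by simp
      ultimately show ?thesis by (rule order_trans[rotated])
    next
      case False
      then have pos: "0 < \<sigma>" using \<sigma> by simp
      define \<nu> where "\<nu> = \<sigma> powr (- 1 / q)"
      have \<nu>: "1 \<le> \<nu>"
        using pos \<sigma> q powr_mono'[of "- 1 / q" 0 \<sigma>] by (simp add: \<nu>_def)
      have \<nu>q: "\<nu> powr q = 1 / \<sigma>"
      proof -
        have "\<nu> powr q = \<sigma> powr (- 1)" using q by (simp only: \<nu>_def powr_powr) simp
        then show ?thesis using pos by (simp add: powr_minus_divide)
      qed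
      define G where "G = (\<lambda>z. of_real \<nu> * f z)"
      have Gmean: "hardy_mean q G r = hardy_mean q f r / \<sigma>" for r
        unfolding G_def hardy_mean_cmult norm_of_real using \<nu> \<nu>q by simp
      have Gbdd: "bdd_above (hardy_mean q G ` {0<..<1})"
        using le pos by (auto intro!: bdd_aboveI2[where M = 1] simp: Gmean divide_le_eq)
      have "(SUP r\<in>{0<..<1}. hardy_mean q G r) = 1"
      proof (rule antisym)
        show "(SUP r\<in>{0<..<1}. hardy_mean q G r) \<le> 1"
          using le pos by (intro cSUP_least) (auto simp: Gmean divide_le_eq)
        have "(SUP r\<in>{0<..<1}. hardy_mean q f r) \<le> (SUP r\<in>{0<..<1}. hardy_mean q G r) * \<sigma>"
        proof (rule cSUP_least)
          fix r :: real assume "r \<in> {0<..<1}"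
          then have "hardy_mean q G r \<le> (SUP r\<in>{0<..<1}. hardy_mean q G r)"
            using Gbdd by (intro cSUP_upper) auto
          then show "hardy_mean q f r \<le> (SUP r\<in>{0<..<1}. hardy_mean q G r) * \<sigma>"
            using pos by (simp add: Gmean divide_le_eq)
        qed auto
        then show "1 \<le> (SUP r\<in>{0<..<1}. hardy_mean q G r)"
          unfolding \<sigma>_def[symmetric] using pos by simp
      qed
      moreover have "G holomorphic_on ball 0 1"
        unfolding G_def using fh by (intro holomorphic_intros holomorphic_on_subset[OF fh]) auto
      ultimately have "G \<in> {g \<in> hardy_space q. hardy_norm q g = 1}"
        using Gbdd by (simp add: hardy_space_def hardy_norm_def)
      then have "ereal (cmod (eval_sum a n G)) \<le> ?S" by (rule SUP_upper)
      moreover have "cmod (eval_sum a n f) \<le> cmod (eval_sum a n G)"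
        using \<nu> by (simp add: G_def eval_sum_cmult norm_mult mult_le_cancel_right1)
      ultimately show ?thesis by (meson ereal_less_eq(3) order_trans)
    qed
  qed
qed

section \<open>Strict monotonicity\<close>

text \<open>
  If \<open>M\<close> is the supremum for \<open>m\<close> and the supremum for \<open>m + 1\<close> is no larger, then \<open>E = (1 - M^p) / p\<close> is a
  lower bound for the gaps with \<open>m + 1\<close> nodes, while near-maximizers for \<open>m\<close>, suitably scaled, have a
  gap arbitrarily close to \<open>E\<close>. The contraction gives \<open>E \<le> (1 - c) E\<close>, which is impossible as \<open>E > 0\<close>.
\<close>
lemma hardy_sphere_SUP_strict_step:
  assumes q: "1 < q" and inj: "inj_on a {1..Suc m}"
    and a: "\<And>k. k \<in> {1..Suc m} \<Longrightarrow> cmod (a k) < 1 \<and> a k \<noteq> 0"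
  shows "(SUP g\<in>{g \<in> hardy_space q. hardy_norm q g = 1}. ereal (cmod (eval_sum a m g)))
       < (SUP g\<in>{g \<in> hardy_space q. hardy_norm q g = 1}. ereal (cmod (eval_sum a (Suc m) g)))"
proof (rule ccontr)
  define U where "U = {f. f analytic_on cball 0 1 \<and> hardy_mean q f 1 \<le> 1}"
  define S where "S = (\<lambda>n. SUP f\<in>U. ereal (cmod (eval_sum a n f)))"
  define p where "p = q / (q - 1)"
  have p: "1 < p" "1 / q + 1 / p = 1" using q by (auto simp: p_def field_simps)
  have a1: "\<And>k. k \<in> {1..Suc m} \<Longrightarrow> cmod (a k) < 1" using a by simp
  have am: "\<And>k. k \<in> {1..m} \<Longrightarrow> cmod (a k) < 1 \<and> a k \<noteq> 0" using a by simp
  assume "\<not> ?thesis"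
  then have contra: "S (Suc m) \<le> S m"
    using SUP_hardy_sphere_eq[OF q am] SUP_hardy_sphere_eq[OF q a] by (simp add: S_def U_def)
  (* Multiplying by a unimodular constant turns a large modulus of the functional into a small gap. *)
  have rotate: "\<exists>u. cmod u = 1 \<and> u * w = - of_real (cmod w)" for w :: complex
  proof (cases "w = 0")
    case False
    then have "- cnj (sgn w) * w = - of_real (cmod w)"
      using complex_norm_square[of w]
      by (simp add: sgn_div_norm scaleR_conv_of_real field_simps power2_eq_square)
    then show ?thesis using False by (intro exI[of _ "- cnj (sgn w)"]) (simp add: norm_sgn)
  qed (auto intro: exI[of _ 1])
  have gap_scaled: "\<exists>h. h analytic_on cball 0 1 \<and>
      young_gap q a n h = t powr q * hardy_mean q f 1 / q + 1 / p - t * cmod (eval_sum a n f)"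
    if f: "f analytic_on cball 0 1" and t: "0 \<le> t" and n: "n \<le> Suc m" for f t n
  proof -
    obtain u where u: "cmod u = 1" "u * eval_sum a n f = - of_real (cmod (eval_sum a n f))"
      using rotate by blast
    have h: "(\<lambda>z. of_real t * u * f z) analytic_on cball 0 1"
      by (intro analytic_intros f)
    have "young_gap q a n (\<lambda>z. of_real t * u * f z)
        = hardy_mean q (\<lambda>z. of_real t * u * f z) 1 / q + (1 - 1 / q)
          + Re (eval_sum a n (\<lambda>z. of_real t * u * f z))"
      using n a1 inj by (intro young_gap_eq h q) (auto intro: inj_on_subset)
    also have "eval_sum a n (\<lambda>z. of_real t * u * f z) = of_real (- (t * cmod (eval_sum a n f)))"
      unfolding eval_sum_cmult mult.assoc u(2) by simp
    also have "hardy_mean q (\<lambda>z. of_real t * u * f z) 1 = t powr q * hardy_mean q f 1"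
      unfolding hardy_mean_cmult using t u(1) by (simp add: norm_mult)
    also have "1 - 1 / q = 1 / p" using p by linarith
    finally show ?thesis using h by auto
  qed
  obtain \<kappa> where \<kappa>: "0 < \<kappa>" "\<And>f. f analytic_on cball 0 1 \<Longrightarrow> \<kappa> \<le> young_gap q a m f"
    by (rule young_gap_bounded_below[where n = m and a = a, OF q am]) (assumption, rule that)
  have U0: "(\<lambda>_. 0) \<in> U" using q by (simp add: U_def hardy_mean_eq_circle_mean)
  have "S m \<le> 1"
    unfolding S_def
  proof (rule SUP_least)
    fix f assume "f \<in> U"
    then have f: "f analytic_on cball 0 1" "hardy_mean q f 1 \<le> 1" by (auto simp: U_def)
    obtain h where h: "h analytic_on cball 0 1"
      "young_gap q a m h = hardy_mean q f 1 / q + 1 / p - cmod (eval_sum a m f)"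
      using gap_scaled[OF f(1), of 1 m] by auto
    have "hardy_mean q f 1 / q \<le> 1 / q" using f(2) q by (simp add: divide_right_mono)
    then have "cmod (eval_sum a m f) \<le> 1" using \<kappa>(1) \<kappa>(2)[OF h(1)] h(2) p by linarith
    then show "ereal (cmod (eval_sum a m f)) \<le> 1" by simp
  qed
  moreover have "0 \<le> S m"
    unfolding S_def using U0 by (rule SUP_upper2) simp
  ultimately obtain M where M: "S m = ereal M" "0 \<le> M" "M \<le> 1"
    by (cases "S m") auto
  define \<alpha> where "\<alpha> = a (Suc m)"
  define c where "c = ((1 - cmod \<alpha>) / (1 + cmod \<alpha>))\<^sup>2"
  have \<alpha>: "cmod \<alpha> < 1" using a1 by (simp add: \<alpha>_def)
  have c: "0 < c" "c \<le> 1"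
  proof -
    have "0 < (1 - cmod \<alpha>) / (1 + cmod \<alpha>)"
      using \<alpha> by (intro divide_pos_pos add_pos_nonneg) auto
    moreover have "(1 - cmod \<alpha>) / (1 + cmod \<alpha>) \<le> 1"
      by (subst divide_le_eq_1_pos) (auto intro: add_pos_nonneg)
    ultimately show "0 < c" "c \<le> 1" unfolding c_def by (auto intro: power_le_one)
  qed
  have lower: "(1 - M powr p) / p \<le> young_gap q a (Suc m) F" if F: "F analytic_on cball 0 1" for F
  proof -
    define N where "N = hardy_mean q F 1"
    have N: "0 \<le> N" by (simp add: N_def hardy_mean_nonneg)
    have "cmod (eval_sum a (Suc m) F) \<le> (M powr p / p + N / q) + \<delta>" if \<delta>: "0 < \<delta>" for \<delta>
    proof -
      (* The \<delta> keeps the normalizing constant s positive when F vanishes on the circle. *)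
      define s where "s = (N + \<delta>) powr (1 / q)"
      have s: "0 < s" using N \<delta> by (simp add: s_def)
      have sq: "s powr q = N + \<delta>" using N \<delta> q by (simp add: s_def powr_powr)
      have "hardy_mean q (\<lambda>z. of_real (1 / s) * F z) 1 = N / (N + \<delta>)"
        unfolding hardy_mean_cmult norm_of_real using s sq by (simp add: N_def powr_divide)
      also have "\<dots> \<le> 1" using N \<delta> by (simp add: divide_le_eq)
      finally have "(\<lambda>z. of_real (1 / s) * F z) \<in> U"
        unfolding U_def mem_Collect_eq by (intro conjI analytic_intros F)
      then have "ereal (cmod (eval_sum a (Suc m) (\<lambda>z. of_real (1 / s) * F z))) \<le> S (Suc m)"
        unfolding S_def by (rule SUP_upper)
      also have "\<dots> \<le> ereal M" using contra M(1) by simp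
      finally have "cmod (eval_sum a (Suc m) F) \<le> M * s"
        using s unfolding eval_sum_cmult norm_mult norm_of_real by (simp add: divide_le_eq)
      also have "\<dots> \<le> M powr p / p + s powr q / q"
        using M s p q by (intro Youngs_inequality) auto
      also have "s powr q / q \<le> N / q + \<delta>"
        using \<delta> q by (simp add: sq add_divide_distrib divide_le_eq)
      finally show ?thesis by simp
    qed
    then have "cmod (eval_sum a (Suc m) F) \<le> M powr p / p + N / q" by (rule field_le_epsilon)
    moreover have "young_gap q a (Suc m) F = N / q + (1 - 1 / q) + Re (eval_sum a (Suc m) F)"
      unfolding N_def by (rule young_gap_eq[OF F q inj a1])
    moreover have "- cmod (eval_sum a (Suc m) F) \<le> Re (eval_sum a (Suc m) F)"
      using abs_Re_le_cmod[of "eval_sum a (Suc m) F"] by linarith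
    ultimately have "1 / p - M powr p / p \<le> young_gap q a (Suc m) F" using p(2) by linarith
    then show ?thesis by (simp add: diff_divide_distrib)
  qed
  (* The scaling that gives equality in Young's inequality t * M \<le> t^q / q + M^p / p. *)
  define t where "t = M powr (p - 1)"
  have t: "0 \<le> t" "t powr q = M powr p" "t * M = M powr p"
  proof -
    show "t powr q = M powr p" using q by (simp add: t_def powr_powr p_def field_simps)
    show "t * M = M powr p"
      using M p by (cases "M = 0") (auto simp: t_def powr_diff)
  qed (simp add: t_def)
  have upper: "\<exists>h. h analytic_on cball 0 1 \<and> young_gap q a m h \<le> (1 - M powr p) / p + \<delta>"
    if \<delta>: "0 < \<delta>" for \<delta>
  proof -
    define \<epsilon> where "\<epsilon> = \<delta> / (1 + t)"
    have \<epsilon>: "0 < \<epsilon>" "t * \<epsilon> \<le> \<delta>"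
      using \<delta> t(1) by (auto simp: \<epsilon>_def field_simps)
    have "ereal (M - \<epsilon>) < S m" using M \<epsilon> by simp
    then obtain f where "f \<in> U" and L: "M - \<epsilon> < cmod (eval_sum a m f)"
      unfolding S_def less_SUP_iff by auto
    then have f: "f analytic_on cball 0 1" "hardy_mean q f 1 \<le> 1" by (auto simp: U_def)
    obtain h where h: "h analytic_on cball 0 1"
      "young_gap q a m h = t powr q * hardy_mean q f 1 / q + 1 / p - t * cmod (eval_sum a m f)"
      using gap_scaled[OF f(1) t(1), of m] by auto
    have "t powr q * hardy_mean q f 1 / q \<le> M powr p / q"
      unfolding t(2) using f(2) q by (intro divide_right_mono mult_left_le) auto
    moreover have "t * (M - \<epsilon>) \<le> t * cmod (eval_sum a m f)"
      using L t(1) by (intro mult_left_mono) auto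
    ultimately have "young_gap q a m h \<le> M powr p / q + 1 / p - M powr p + \<delta>"
      using h(2) \<epsilon>(2) t(3) by (simp add: right_diff_distrib)
    also have "M powr p / q = M powr p - M powr p / p"
    proof -
      have "M powr p / q + M powr p / p = M powr p * (1 / q + 1 / p)"
        by (simp add: distrib_left)
      then show ?thesis using p(2) by simp
    qed
    finally show ?thesis using h(1) by (auto simp: diff_divide_distrib)
  qed
  define E where "E = (1 - M powr p) / p"
  have "\<kappa> \<le> E + \<delta>" if "0 < \<delta>" for \<delta>
    using upper[OF that] \<kappa>(2) by (fastforce simp: E_def)
  then have Epos: "0 < E" using \<kappa>(1) field_le_epsilon by fastforce
  have "E \<le> (1 - c) * E + \<delta>" if \<delta>: "0 < \<delta>" for \<delta>
  proof -
    obtain h where h: "h analytic_on cball 0 1" "young_gap q a m h \<le> E + \<delta>"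
      using upper[OF \<delta>] by (auto simp: E_def)
    obtain F where F: "F analytic_on cball 0 1" "young_gap q a (Suc m) F \<le> (1 - c) * young_gap q a m h"
      unfolding c_def \<alpha>_def by (rule young_gap_step[OF h(1) q a1])
    have "E \<le> young_gap q a (Suc m) F" using lower[OF F(1)] by (simp add: E_def)
    also note F(2)
    also have "(1 - c) * young_gap q a m h \<le> (1 - c) * (E + \<delta>)"
      using c h(2) by (intro mult_left_mono) auto
    also have "\<dots> \<le> (1 - c) * E + \<delta>" using c \<delta> by (simp add: distrib_left mult_left_le_one_le)
    finally show ?thesis .
  qed
  then have "E \<le> (1 - c) * E" by (rule field_le_epsilon)
  then show False using mult_pos_pos[OF c(1) Epos] by (simp add: left_diff_distrib)
qed

theorem corollary3p8:
  fixes q :: real and a :: "nat \<Rightarrow> complex" and m n :: nat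
  assumes "1 < q"
    and "inj_on a {1..}"
    and "\<And>k. 1 \<le> k \<Longrightarrow> a k \<in> ball 0 1 - {0}"
    and "1 \<le> m" and "m < n"
  shows "(SUP g\<in>{g \<in> hardy_space q. hardy_norm q g = 1}. ereal (cmod (eval_sum a m g)))
       < (SUP g\<in>{g \<in> hardy_space q. hardy_norm q g = 1}. ereal (cmod (eval_sum a n g)))"
proof -
  let ?S = "\<lambda>k. SUP g\<in>{g \<in> hardy_space q. hardy_norm q g = 1}. ereal (cmod (eval_sum a k g))"
  have "?S k < ?S (Suc k)" for k
  proof (rule hardy_sphere_SUP_strict_step[OF \<open>1 < q\<close>])
    show "inj_on a {1..Suc k}" by (rule inj_on_subset[OF assms(2)]) auto
    show "cmod (a j) < 1 \<and> a j \<noteq> 0" if "j \<in> {1..Suc k}" for j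
      using assms(3)[of j] that by simp
  qed
  then show "?S m < ?S n"
    using \<open>m < n\<close> by (rule lift_Suc_mono_less)
qed

end
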